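(* Consider a misère partizan Kayles position. If Left can win it (moving next), then she can win by placing her square at the end of a strip of length congruent to $1$ modulo $3$ when such a move is possible, or at the end of a strip of length congruent to $2$ modulo $3$ otherwise. If Right can win it (moving next), then he can win by placing his domino at the end of a strip of length congruent to $2$ modulo $3$ when such a move is possible, or one cell away from the end of a strip of length congruent to $1$ modulo $3$ otherwise.
   Context: Partizan Kayles is played on $1\times n$ strips of squares. Left moves by placing a single square on one empty cell; Right moves by placing a domino covering two adjacent empty cells of the same strip; a placement splits a strip into the strips of empty cells on either side, so positions are disjunctive sums of strips of empty cells. Under misère play a player unable to move on their turn wins.
   Formalization: If neither kind of described move exists (e.g. a single strip of length 3, or no empty cells), the player may win though no such move exists, so the claim as worded fails; the formal theorem asserts nothing there. Elsewhere it shows every described placement wins. *)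

theory Defs
  imports "HOL-Library.Multiset"
begin

datatype player = Left | Right

fun opponent :: "player \<Rightarrow> player" where
  "opponent Left = Right"
| "opponent Right = Left"

text \<open>Number of consecutive cells covered by one placement.\<close>

fun piece :: "player \<Rightarrow> nat" where
  "piece Left = 1"
| "piece Right = 2"

text \<open>A position is the multiset of the lengths of its strips of empty cells. Strips of length
  \<open>0\<close> may occur (a placement at an end creates one); nobody can move in them.\<close>

type_synonym position = "nat multiset"

text \<open>A placement is a pair \<open>(n, i)\<close>: the piece goes into a strip of length \<open>n\<close>, leaving \<open>i\<close> empty
  cells on one side of it and \<open>n - piece P - i\<close> on the other.\<close>

definition legal :: "player \<Rightarrow> position \<Rightarrow> (nat \<times> nat) set" where
  "legal P G = {(n, i). n \<in># G \<and> i + piece P \<le> n}"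

fun play :: "player \<Rightarrow> position \<Rightarrow> nat \<times> nat \<Rightarrow> position" where
  "play P G (n, i) = G - {#n#} + {#i, n - piece P - i#}"

lemma play_decreases:
  assumes "m \<in> legal P G"
  shows "sum_mset (play P G m) < sum_mset G"
proof -
  obtain n i where m: "m = (n, i)" by (cases m)
  have n: "n \<in># G" and i: "i + piece P \<le> n" using assms m by (auto simp: legal_def)
  obtain H where "G = add_mset n H" using multi_member_split [OF n] by blast
  moreover have "piece P > 0" by (cases P) simp_all
  ultimately show ?thesis using m i by simp
qed

text \<open>\<open>wins_next P G\<close>: under misere play, \<open>P\<close> has a winning strategy on \<open>G\<close> when \<open>P\<close> is the next
  player to move.\<close>

function wins_next :: "player \<Rightarrow> position \<Rightarrow> bool" where
  "wins_next P G \<longleftrightarrow>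
     legal P G = {} \<or> (\<exists>m\<in>legal P G. \<not> wins_next (opponent P) (play P G m))"
  by pat_completeness auto
termination
  by (relation "measure (\<lambda>(P, G). sum_mset G)") (auto intro: play_decreases)

declare wins_next.simps [simp del]

definition winning_move :: "player \<Rightarrow> position \<Rightarrow> nat \<times> nat \<Rightarrow> bool" where
  "winning_move P G m \<longleftrightarrow> m \<in> legal P G \<and> \<not> wins_next (opponent P) (play P G m)"

text \<open>Legal placements in a strip of length congruent to \<open>r\<close> modulo \<open>3\<close> that leave exactly \<open>d\<close>
  empty cells between the piece and one of the two ends of the strip. There need not be any: if all
  strip lengths are divisible by \<open>3\<close>, then there are none with \<open>r = 1\<close> or \<open>r = 2\<close>, and a
  strip of length \<open>1\<close> admits no domino at all.\<close>

definition placements :: "player \<Rightarrow> nat \<Rightarrow> nat \<Rightarrow> position \<Rightarrow> (nat \<times> nat) set" where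
  "placements P d r G =
     {(n, i) \<in> legal P G. n mod 3 = r \<and> (i = d \<or> i + piece P + d = n)}"

end

theory Submission
  imports Defs
begin

text \<open>
  Let \<open>d\<close> be the number of strips of length \<open>1\<close> modulo \<open>3\<close> minus the number of strips of length
  \<open>2\<close> modulo \<open>3\<close>. Every Left move changes \<open>d\<close> by \<open>-1\<close> or \<open>+2\<close>, and every Right move changes it by
  \<open>+1\<close> or \<open>-2\<close>, so only the size of \<open>d\<close>, and not its residue modulo \<open>3\<close>, depends on the choice of
  the move. By induction, Left wins moving next iff \<open>d \<le> 0\<close> and \<open>d \<equiv> 0\<close>, and Right loses moving
  next iff \<open>d < 0\<close> and \<open>d \<equiv> 2\<close> modulo \<open>3\<close>. Hence a winning Left keeps her win with any move that
  lowers \<open>d\<close>, or with any move at all if \<open>d < 0\<close>, and a winning Right with any move that raises \<open>d\<close>.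
\<close>

section \<open>The value of a position and its change under a move\<close>

definition strip_value :: "nat \<Rightarrow> int" where
  "strip_value n = (if n mod 3 = 1 then 1 else if n mod 3 = 2 then -1 else 0)"

definition pos_value :: "position \<Rightarrow> int" where
  "pos_value G = (\<Sum>n\<in>#G. strip_value n)"

lemma strip_value_add_3 [simp]: "strip_value (Suc (Suc (Suc n))) = strip_value n"
  unfolding strip_value_def by presburger

lemma strip_value_0 [simp]: "strip_value 0 = 0"
  by (simp add: strip_value_def)

lemma strip_value_mod_3: "strip_value (n mod 3) = strip_value n"
  by (simp add: strip_value_def)

lemma mod_3_cases: "(n::nat) mod 3 \<in> {0, 1, 2}"
  by auto

text \<open>\<open>strip_value n\<close> is the representative of n modulo 3 in {-1, 0, 1}. So the
  change is congruent to -1 modulo 3 and at most 3 in absolute value, which leaves only -1 and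
  2.\<close>

lemma strip_value_Left_move:
  "strip_value i + strip_value j - strip_value (i + j + 1) \<in> {-1, 2}"
proof -
  \<comment> \<open>Only residues matter, so nine pairs are enough.\<close>
  have "strip_value a + strip_value b - strip_value (a + b + 1) \<in> {-1, 2}"
    if "a \<in> {0, 1, 2}" "b \<in> {0, 1, 2}" for a b
    using that by (auto simp: strip_value_def)
  from this [OF mod_3_cases mod_3_cases, of i j]
  have "strip_value i + strip_value j - strip_value (i mod 3 + j mod 3 + 1) \<in> {-1, 2}"
    by (simp only: strip_value_mod_3)
  moreover have "(i mod 3 + j mod 3 + 1) mod 3 = (i + j + 1) mod 3"
    by (intro mod_add_cong refl) simp_all
  ultimately show ?thesis
    by (metis strip_value_mod_3)
qed

lemma strip_value_Right_move:
  "strip_value i + strip_value j - strip_value (i + j + 2) \<in> {1, -2}"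
proof -
  have "strip_value a + strip_value b - strip_value (a + b + 2) \<in> {1, -2}"
    if "a \<in> {0, 1, 2}" "b \<in> {0, 1, 2}" for a b
    using that by (auto simp: strip_value_def)
  from this [OF mod_3_cases mod_3_cases, of i j]
  have "strip_value i + strip_value j - strip_value (i mod 3 + j mod 3 + 2) \<in> {1, -2}"
    by (simp only: strip_value_mod_3)
  moreover have "(i mod 3 + j mod 3 + 2) mod 3 = (i + j + 2) mod 3"
    by (intro mod_add_cong refl) simp_all
  ultimately show ?thesis
    by (metis strip_value_mod_3)
qed

lemma pos_value_play:
  assumes "(n, i) \<in> legal P G"
  shows "pos_value (play P G (n, i)) =
    pos_value G + (strip_value i + strip_value (n - piece P - i) - strip_value n)"
proof -
  obtain H where "G = add_mset n H"
    using assms multi_member_split [of n G] by (auto simp: legal_def)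
  then show ?thesis
    by (simp add: pos_value_def)
qed

lemma pos_value_play_Left:
  assumes "m \<in> legal Left G"
  shows "pos_value (play Left G m) \<in> {pos_value G - 1, pos_value G + 2}"
proof -
  obtain n i where m: "m = (n, i)" by (cases m)
  have "i + 1 \<le> n"
    using assms m by (simp add: legal_def)
  then obtain j where n: "n = i + j + 1"
    by (metis le_Suc_ex add.assoc add.commute)
  have "pos_value (play Left G m) =
      pos_value G + (strip_value i + strip_value j - strip_value (i + j + 1))"
    using pos_value_play [of n i Left G] assms unfolding m n by simp
  then show ?thesis
    using strip_value_Left_move [of i j] by auto
qed

lemma pos_value_play_Right:
  assumes "m \<in> legal Right G"
  shows "pos_value (play Right G m) \<in> {pos_value G + 1, pos_value G - 2}"
proof -
  obtain n i where m: "m = (n, i)" by (cases m)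
  have "i + 2 \<le> n"
    using assms m by (simp add: legal_def)
  then obtain j where n: "n = i + j + 2"
    by (metis le_Suc_ex add.assoc add.commute)
  have "pos_value (play Right G m) =
      pos_value G + (strip_value i + strip_value j - strip_value (i + j + 2))"
    using pos_value_play [of n i Right G] assms unfolding m n by simp
  then show ?thesis
    using strip_value_Right_move [of i j] by auto
qed

section \<open>The sign of the value, and moves that change it by one\<close>

lemma pos_value_nonneg:
  assumes "\<forall>n\<in>#G. n mod 3 \<noteq> 2"
  shows "pos_value G \<ge> 0"
  using assms by (induction G) (auto simp: pos_value_def strip_value_def)

lemma pos_value_nonpos:
  assumes "\<forall>n\<in>#G. n mod 3 \<noteq> 1"
  shows "pos_value G \<le> 0"
  using assms by (induction G) (auto simp: pos_value_def strip_value_def)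

lemma pos_value_neg:
  assumes "\<forall>n\<in>#G. n mod 3 \<noteq> 1" "k \<in># G" "k mod 3 = 2"
  shows "pos_value G < 0"
proof -
  obtain H where "G = add_mset k H"
    using assms(2) multi_member_split by metis
  then show ?thesis
    using pos_value_nonpos [of H] assms(1,3) by (auto simp: pos_value_def strip_value_def)
qed

text \<open>A negative value needs a strip of length 2 modulo 3, hence of length at least 2, where
  either piece fits.\<close>

lemma pos_value_neg_imp_legal:
  assumes "pos_value G < 0"
  shows "legal P G \<noteq> {}"
proof -
  obtain n where "n \<in># G" "n mod 3 = 2"
    using assms pos_value_nonneg [of G] by force
  moreover from this have "0 + piece P \<le> n"
    by (cases P) (auto intro: ccontr)
  ultimately show ?thesis
    unfolding legal_def by blast
qed

text \<open>An end move shortens the strip by one cell. Residues 1 to 0 and 0 to 2 cost one; only 2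
  to 1 would gain two.\<close>

lemma Left_lowering_move:
  assumes "(n, i) \<in> legal Left G" "n mod 3 \<noteq> 2" "i = 0 \<or> i + 1 = n"
  shows "pos_value (play Left G (n, i)) = pos_value G - 1"
proof -
  obtain j where n: "n = Suc j"
    using assms(1) by (cases n) (auto simp: legal_def)
  have "strip_value j - strip_value (Suc j) = -1"
    using assms(2) unfolding n strip_value_def by presburger
  then show ?thesis
    using pos_value_play [OF assms(1)] assms(3) n by auto
qed

text \<open>Shortening by two cells takes residue 2 to 0 or 0 to 1, a gain of one; only 1 to 2 would
  lose two.\<close>

lemma Right_raising_move_at_end:
  assumes "(n, i) \<in> legal Right G" "n mod 3 \<noteq> 1" "i = 0 \<or> i + 2 = n"
  shows "pos_value (play Right G (n, i)) = pos_value G + 1"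
proof -
  have "2 \<le> n"
    using assms(1) by (simp add: legal_def)
  then obtain j where n: "n = Suc (Suc j)"
    by (metis add_2_eq_Suc le_Suc_ex)
  have "strip_value j - strip_value (Suc (Suc j)) = 1"
    using assms(2) unfolding n strip_value_def by presburger
  then show ?thesis
    using pos_value_play [OF assms(1)] assms(3) n by auto
qed

text \<open>The strip, of value 1, is replaced by strips of lengths 1 and n - 3, each again of value
  1.\<close>

lemma Right_raising_move_near_end:
  assumes "(n, i) \<in> legal Right G" "n mod 3 = 1" "i = 1 \<or> i + 3 = n"
  shows "pos_value (play Right G (n, i)) = pos_value G + 1"
proof -
  have i: "i + 2 \<le> n"
    using assms(1) by (simp add: legal_def)
  with assms(2,3) have "n \<ge> 3"
    by auto
  then obtain j where n: "n = Suc (Suc (Suc j))"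
    by (metis Suc_le_D numeral_3_eq_3 Suc_le_mono)
  have "strip_value j = 1" "strip_value 1 = 1"
    using assms(2) unfolding n by (auto simp: strip_value_def)
  then show ?thesis
    using pos_value_play [OF assms(1)] assms(3) n by auto
qed

text \<open>Were all nonempty strips of length 2 modulo 3, the value would be negative instead of 0;
  any other nonempty strip has a lowering move at its end.\<close>

lemma Left_lowering_move_exists:
  assumes "pos_value G = 0" "legal Left G \<noteq> {}"
  shows "\<exists>m\<in>legal Left G. pos_value (play Left G m) = pos_value G - 1"
proof -
  obtain k where k: "k \<in># G" "k \<ge> 1"
    using assms(2) by (auto simp: legal_def)
  have "\<exists>n\<in>#G. n \<ge> 1 \<and> n mod 3 \<noteq> 2"
  proof (rule ccontr)
    assume *: "\<not> ?thesis"
    then have "\<forall>n\<in>#G. n mod 3 \<noteq> 1"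
      by force
    moreover have "k mod 3 = 2"
      using * k by blast
    ultimately show False
      using pos_value_neg [OF _ k(1)] assms(1) by simp
  qed
  then obtain n where n: "n \<in># G" "n \<ge> 1" "n mod 3 \<noteq> 2" by blast
  then have "(n, 0) \<in> legal Left G"
    by (simp add: legal_def)
  with Left_lowering_move [OF this] n show ?thesis
    by blast
qed

text \<open>Every strip that admits a domino offers such a move, at its end or one cell away from it
  according to its residue.\<close>

lemma Right_raising_move_exists:
  assumes "legal Right G \<noteq> {}"
  shows "\<exists>m\<in>legal Right G. pos_value (play Right G m) = pos_value G + 1"
proof -
  obtain n where n: "n \<in># G" "n \<ge> 2"
    using assms by (auto simp: legal_def)
  show ?thesis
  proof (cases "n mod 3 = 1")
    case True
    then have "n \<noteq> 2" by auto
    with n have "(n, 1) \<in> legal Right G"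
      by (simp add: legal_def)
    with Right_raising_move_near_end [OF this True] show ?thesis
      by blast
  next
    case False
    have "(n, 0) \<in> legal Right G"
      using n by (simp add: legal_def)
    with Right_raising_move_at_end [OF this False] show ?thesis
      by blast
  qed
qed

section \<open>Winning conditions and the outcome of every position\<close>

definition Left_condition :: "int \<Rightarrow> bool" where
  "Left_condition d \<longleftrightarrow> d \<le> 0 \<and> d mod 3 = 0"

text \<open>The excluded values are exactly the numbers d - 1 with
  \<open>Left_condition d\<close>.\<close>

definition Right_condition :: "int \<Rightarrow> bool" where
  "Right_condition d \<longleftrightarrow> \<not> (d < 0 \<and> d mod 3 = 2)"

lemma Left_condition_if_move:
  assumes "e \<in> {d - 1, d + 2}" "\<not> Right_condition e"
  shows "Left_condition d"
  using assms unfolding Left_condition_def Right_condition_def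
  by (elim insertE emptyE; hypsubst; presburger)

text \<open>A negative multiple of 3 is at most -3, so even d + 2 stays negative.\<close>

lemma not_Right_condition_if_neg:
  assumes "e \<in> {d - 1, d + 2}" "Left_condition d" "d < 0"
  shows "\<not> Right_condition e"
  using assms unfolding Left_condition_def Right_condition_def
  by (elim insertE emptyE; hypsubst; presburger)

lemma not_Right_condition_lowered:
  assumes "Left_condition d"
  shows "\<not> Right_condition (d - 1)"
  using assms unfolding Left_condition_def Right_condition_def by presburger

lemma Right_condition_if_move:
  assumes "e \<in> {d + 1, d - 2}" "\<not> Left_condition e"
  shows "Right_condition d"
  using assms unfolding Left_condition_def Right_condition_def
  by (elim insertE emptyE; hypsubst; presburger)

lemma not_Left_condition_raised:
  assumes "Right_condition d"
  shows "\<not> Left_condition (d + 1)"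
  using assms unfolding Left_condition_def Right_condition_def by presburger

text \<open>The induction step for Left; the assumption is the induction hypothesis for her
  options.\<close>

lemma Left_wins_iff_aux:
  assumes "\<And>m. m \<in> legal Left G \<Longrightarrow>
    wins_next Right (play Left G m) \<longleftrightarrow> Right_condition (pos_value (play Left G m))"
  shows "wins_next Left G \<longleftrightarrow> Left_condition (pos_value G)"
proof -
  have eq: "wins_next Left G \<longleftrightarrow>
    legal Left G = {} \<or> (\<exists>m\<in>legal Left G. \<not> Right_condition (pos_value (play Left G m)))"
    using assms by (subst wins_next.simps) simp
  show ?thesis
  proof (cases "legal Left G = {}")
    case True
    \<comment> \<open>Left is stuck, and so wins, only when all strips are empty; the value is then
      0, which meets her condition.\<close>
    have "n = 0" if "n \<in># G" for n
    proof (rule ccontr)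
      assume "n \<noteq> 0"
      then have "(n, 0) \<in> legal Left G"
        using that by (simp add: legal_def)
      with True show False by blast
    qed
    then have "pos_value G = 0"
      unfolding pos_value_def by (intro sum_mset.neutral) (metis image_iff set_image_mset strip_value_0)
    with True show ?thesis
      by (simp add: eq Left_condition_def)
  next
    case False
    show ?thesis
    proof
      assume "wins_next Left G"
      then obtain m where "m \<in> legal Left G" "\<not> Right_condition (pos_value (play Left G m))"
        using eq False by blast
      then show "Left_condition (pos_value G)"
        using Left_condition_if_move pos_value_play_Left by blast
    next
      assume L: "Left_condition (pos_value G)"
      show "wins_next Left G"
      \<comment> \<open>At value 0 a move to 2 would let Right win, so a lowering move is required;
        at a negative value any move will do.\<close>
      proof (cases "pos_value G = 0")
        case True
        then show ?thesis
          using Left_lowering_move_exists [OF True False] eq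
          by (force simp: Right_condition_def)
      next
        case nz: False
        obtain m where "m \<in> legal Left G"
          using False by blast
        moreover from pos_value_play_Left [OF this]
        have "\<not> Right_condition (pos_value (play Left G m))"
          using L nz by (intro not_Right_condition_if_neg) (auto simp: Left_condition_def)
        ultimately show ?thesis
          using eq by blast
      qed
    qed
  qed
qed

lemma Right_wins_iff_aux:
  assumes "\<And>m. m \<in> legal Right G \<Longrightarrow>
    wins_next Left (play Right G m) \<longleftrightarrow> Left_condition (pos_value (play Right G m))"
  shows "wins_next Right G \<longleftrightarrow> Right_condition (pos_value G)"
proof -
  have eq: "wins_next Right G \<longleftrightarrow>
    legal Right G = {} \<or> (\<exists>m\<in>legal Right G. \<not> Left_condition (pos_value (play Right G m)))"
    using assms by (subst wins_next.simps) simp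
  show ?thesis
  proof (cases "legal Right G = {}")
    case True
    \<comment> \<open>A stuck Right wins, and his condition holds because the value cannot be
      negative.\<close>
    then show ?thesis
      using pos_value_neg_imp_legal [of G Right] by (auto simp: eq Right_condition_def)
  next
    case False
    show ?thesis
    proof
      assume "wins_next Right G"
      then obtain m where "m \<in> legal Right G" "\<not> Left_condition (pos_value (play Right G m))"
        using eq False by blast
      then show "Right_condition (pos_value G)"
        using Right_condition_if_move pos_value_play_Right by blast
    next
      assume R: "Right_condition (pos_value G)"
      obtain m where "m \<in> legal Right G" "pos_value (play Right G m) = pos_value G + 1"
        using Right_raising_move_exists [OF False] by blast
      moreover have "\<not> Left_condition (pos_value G + 1)"
        by (rule not_Left_condition_raised [OF R])
      ultimately show "wins_next Right G"
        using eq by metis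
    qed
  qed
qed

text \<open>Both players are treated in one induction on the number of empty cells, since the turns
  alternate.\<close>

lemma wins_next_iff:
  "wins_next P G \<longleftrightarrow>
    (case P of Left \<Rightarrow> Left_condition (pos_value G) | Right \<Rightarrow> Right_condition (pos_value G))"
proof (induction "sum_mset G" arbitrary: P G rule: less_induct)
  case less
  note IH = less.hyps [OF play_decreases]
  show ?case
    using Left_wins_iff_aux [of G] Right_wins_iff_aux [of G] IH
    by (cases P) auto
qed

section \<open>From outcomes to winning moves\<close>

lemma winning_move_Left_iff:
  "winning_move Left G m \<longleftrightarrow> m \<in> legal Left G \<and> \<not> Right_condition (pos_value (play Left G m))"
  by (simp add: winning_move_def wins_next_iff)

lemma winning_move_Right_iff:
  "winning_move Right G m \<longleftrightarrow> m \<in> legal Right G \<and> \<not> Left_condition (pos_value (play Right G m))"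
  by (simp add: winning_move_def wins_next_iff)

lemma Left_wins_by_lowering:
  assumes "wins_next Left G" "m \<in> legal Left G" "pos_value (play Left G m) = pos_value G - 1"
  shows "winning_move Left G m"
proof -
  have "Left_condition (pos_value G)"
    using assms(1) by (simp add: wins_next_iff)
  then have "\<not> Right_condition (pos_value G - 1)"
    by (rule not_Right_condition_lowered)
  then show ?thesis
    using assms(2,3) by (simp add: winning_move_Left_iff)
qed

lemma Left_wins_by_any_move:
  assumes "wins_next Left G" "m \<in> legal Left G" "pos_value G < 0"
  shows "winning_move Left G m"
proof -
  have "Left_condition (pos_value G)"
    using assms(1) by (simp add: wins_next_iff)
  then have "\<not> Right_condition (pos_value (play Left G m))"
    using not_Right_condition_if_neg [OF pos_value_play_Left [OF assms(2)]] assms(3) by blast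
  then show ?thesis
    using assms(2) by (simp add: winning_move_Left_iff)
qed

lemma Right_wins_by_raising:
  assumes "wins_next Right G" "m \<in> legal Right G" "pos_value (play Right G m) = pos_value G + 1"
  shows "winning_move Right G m"
proof -
  have "Right_condition (pos_value G)"
    using assms(1) by (simp add: wins_next_iff)
  then have "\<not> Left_condition (pos_value G + 1)"
    by (rule not_Left_condition_raised)
  then show ?thesis
    using assms(2,3) by (simp add: winning_move_Right_iff)
qed

theorem theorem4p5:
  fixes G :: position
  shows "(wins_next Left G \<longrightarrow>
            (if placements Left 0 1 G \<noteq> {}
             then \<forall>m\<in>placements Left 0 1 G. winning_move Left G m
             else \<forall>m\<in>placements Left 0 2 G. winning_move Left G m)) \<and>
         (wins_next Right G \<longrightarrow>
            (if placements Right 0 2 G \<noteq> {}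
             then \<forall>m\<in>placements Right 0 2 G. winning_move Right G m
             else \<forall>m\<in>placements Right 1 1 G. winning_move Right G m))"
proof -
  have L1: "winning_move Left G m" if "wins_next Left G" "m \<in> placements Left 0 1 G" for m
  proof -
    obtain n i where m: "m = (n, i)" by (cases m)
    have "m \<in> legal Left G" "n mod 3 \<noteq> 2" "i = 0 \<or> i + 1 = n"
      using that(2) m by (auto simp: placements_def)
    then show ?thesis
      using Left_wins_by_lowering [OF that(1)] Left_lowering_move m by blast
  qed
  have L2: "winning_move Left G m"
    if "wins_next Left G" "placements Left 0 1 G = {}" "m \<in> placements Left 0 2 G" for m
  proof -
    obtain n i where m: "m = (n, i)" by (cases m)
    have n: "m \<in> legal Left G" "n \<in># G" "n mod 3 = 2"
      using that(3) m by (auto simp: placements_def legal_def)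
    \<comment> \<open>A strip of length 1 modulo 3 is nonempty and always admits a square at its
      end. Without such strips, the strip n makes the value negative, and then every Left move keeps
      the win.\<close>
    have "k mod 3 \<noteq> 1" if "k \<in># G" for k
    proof
      assume "k mod 3 = 1"
      moreover from this have "1 \<le> k" by (cases k) auto
      ultimately have "(k, 0) \<in> placements Left 0 1 G"
        using that by (simp add: placements_def legal_def)
      with \<open>placements Left 0 1 G = {}\<close> show False by blast
    qed
    then have "pos_value G < 0"
      using pos_value_neg n(2,3) by blast
    then show ?thesis
      using Left_wins_by_any_move [OF that(1) n(1)] by blast
  qed
  have R1: "winning_move Right G m" if "wins_next Right G" "m \<in> placements Right 0 2 G" for m
  proof -
    obtain n i where m: "m = (n, i)" by (cases m)
    have "m \<in> legal Right G" "n mod 3 \<noteq> 1" "i = 0 \<or> i + 2 = n"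
      using that(2) m by (auto simp: placements_def)
    then show ?thesis
      using Right_wins_by_raising [OF that(1)] Right_raising_move_at_end m by blast
  qed
  have R2: "winning_move Right G m" if "wins_next Right G" "m \<in> placements Right 1 1 G" for m
  proof -
    obtain n i where m: "m = (n, i)" by (cases m)
    have "m \<in> legal Right G" "n mod 3 = 1" "i = 1 \<or> i + 3 = n"
      using that(2) m by (auto simp: placements_def)
    then show ?thesis
      using Right_wins_by_raising [OF that(1)] Right_raising_move_near_end m by blast
  qed
  show ?thesis
    using L1 L2 R1 R2 by simp
qed

end
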